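(* Let $\pi=M_1B_1\cdots M_tB_t$ be the ltr-max decomposition of a permutation of length $n$. Then $\pi$ is $(123,312)$-sortable if and only if the following four conditions are satisfied: \begin{enumerate} \item $M_j=n-t+j$, for each $j=1,\dots,t$. \item $B_i$ avoids $213$, for each $i$. \item $\pi$ avoids $2\text{-}3\text{-}1$: there are no $x\in B_i$, $y\in B_j$, $z\in B_k$ with $i<j<k$ and $z<x<y$. \item $\pi$ avoids $2\text{-}31$: there are no $x\in B_i$ and $y,z\in B_j$ with $i<j$ and $z<x<y$. \end{enumerate}
   Context: A sequence avoids a pattern $\tau$ if none of its subsequences is order isomorphic to $\tau$. The ltr-max decomposition of $\pi$ is $\pi=M_1B_1M_2B_2\cdots M_tB_t$, where $M_1<\dots<M_t$ are the left-to-right maxima of $\pi$ (entries larger than all preceding entries) and $B_i$ is the (possibly empty) block of entries strictly between $M_i$ and $M_{i+1}$ (following $M_t$, for $i=t$). For a set $\Sigma$ of permutations of length at least $2$, the $\Sigma$-stack acts on an input permutation $\pi=\pi_1\cdots\pi_n$ as follows (starting with empty stack and output). For $i=1,\dots,n$: as long as pushing $\pi_i$ on top of the stack would make the content of the stack, read from top to bottom, contain an occurrence of some $\sigma\in\Sigma$, pop the top element and append it to the output; then push $\pi_i$. After all letters have been pushed, pop all remaining elements, from top to bottom, appending them to the output. The resulting output is denoted $\mathcal{S}^{\Sigma}(\pi)$. The permutation $\pi$ of length $n$ is $\Sigma$-sortable if $\mathcal{S}^{21}(\mathcal{S}^{\Sigma}(\pi))=12\cdots n$, where $\mathcal{S}^{21}=\mathcal{S}^{\{21\}}$.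 For $\Sigma=\{\sigma,\tau\}$ one writes $(\sigma,\tau)$-sortable. *)

theory Defs
  imports "HOL-Library.Sublist" "HOL-Combinatorics.Multiset_Permutations"
begin

text \<open>A permutation of length \<open>n\<close> is given in one-line notation, i.e. as an element
  of \<open>permutations_of_set {1..n}\<close>.\<close>

definition order_iso :: "nat list \<Rightarrow> nat list \<Rightarrow> bool" where
  "order_iso xs ys \<longleftrightarrow> length xs = length ys \<and>
     (\<forall>i<length xs. \<forall>j<length xs. xs ! i < xs ! j \<longleftrightarrow> ys ! i < ys ! j)"

definition contains_pattern :: "nat list \<Rightarrow> nat list \<Rightarrow> bool" where
  "contains_pattern w \<tau> \<longleftrightarrow> (\<exists>s. subseq s w \<and> order_iso s \<tau>)"

abbreviation avoids :: "nat list \<Rightarrow> nat list \<Rightarrow> bool" where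
  "avoids w \<tau> \<equiv> \<not> contains_pattern w \<tau>"

text \<open>Stacks are lists with the top element first. \<open>pop_before_push \<Sigma> x st\<close> returns the
  elements popped, in order of popping, before \<open>x\<close> can be pushed onto \<open>st\<close>, together with
  the remaining stack.\<close>

fun pop_before_push :: "nat list set \<Rightarrow> nat \<Rightarrow> nat list \<Rightarrow> nat list \<times> nat list" where
  "pop_before_push \<Sigma> x [] = ([], [])"
| "pop_before_push \<Sigma> x (s # st) =
     (if \<exists>\<sigma>\<in>\<Sigma>. contains_pattern (x # s # st) \<sigma>
      then (let (popped, rest) = pop_before_push \<Sigma> x st in (s # popped, rest))
      else ([], s # st))"

text \<open>\<open>stack_run \<Sigma> xs st\<close> is the output still to be produced when the stack content is
  \<open>st\<close> and the remaining input is \<open>xs\<close>.\<close>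

fun stack_run :: "nat list set \<Rightarrow> nat list \<Rightarrow> nat list \<Rightarrow> nat list" where
  "stack_run \<Sigma> [] st = st"
| "stack_run \<Sigma> (x # xs) st =
     (let (popped, rest) = pop_before_push \<Sigma> x st in popped @ stack_run \<Sigma> xs (x # rest))"

definition stack_map :: "nat list set \<Rightarrow> nat list \<Rightarrow> nat list" where
  "stack_map \<Sigma> \<pi> = stack_run \<Sigma> \<pi> []"

definition sortable :: "nat list set \<Rightarrow> nat list \<Rightarrow> bool" where
  "sortable \<Sigma> \<pi> \<longleftrightarrow> stack_map {[2, 1]} (stack_map \<Sigma> \<pi>) = [1..<length \<pi> + 1]"

definition is_ltr_max :: "nat list \<Rightarrow> nat \<Rightarrow> bool" where
  "is_ltr_max \<pi> x \<longleftrightarrow> (\<exists>us vs. \<pi> = us @ x # vs \<and> (\<forall>u\<in>set us. u < x))"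

text \<open>\<open>Ms = [M\<^sub>1, \<dots>, M\<^sub>t]\<close> and \<open>Bs = [B\<^sub>1, \<dots>, B\<^sub>t]\<close>. The entries of a permutation are distinct,
  so these lists are uniquely determined by it.\<close>

definition ltr_max_decomposition :: "nat list \<Rightarrow> nat list \<Rightarrow> nat list list \<Rightarrow> bool" where
  "ltr_max_decomposition \<pi> Ms Bs \<longleftrightarrow>
     Ms = filter (is_ltr_max \<pi>) \<pi> \<and> length Bs = length Ms \<and>
     \<pi> = concat (map2 (#) Ms Bs)"

lemma blocks_exist:
  assumes "xs \<noteq> [] \<Longrightarrow> P (hd xs)"
  shows "\<exists>Bs. length Bs = length (filter P xs) \<and> xs = concat (map2 (#) (filter P xs) Bs)"
  using assms
proof (induction xs rule: rev_induct)
  case Nil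
  then show ?case by simp
next
  case (snoc x xs)
  have "xs \<noteq> [] \<Longrightarrow> P (hd xs)" using snoc.prems by (cases xs) auto
  then obtain Bs where Bs: "length Bs = length (filter P xs)"
    "xs = concat (map2 (#) (filter P xs) Bs)"
    using snoc.IH by blast
  show ?case
  proof (cases "P x")
    case True
    have "length (Bs @ [[]]) = length (filter P (xs @ [x])) \<and>
      xs @ [x] = concat (map2 (#) (filter P (xs @ [x])) (Bs @ [[]]))"
      using Bs True by simp
    then show ?thesis by blast
  next
    case False
    then have "xs \<noteq> []" using snoc.prems by (cases xs) auto
    then have "filter P xs \<noteq> []" using snoc.prems by (cases xs) auto
    then obtain Ms' m where Ms: "filter P xs = Ms' @ [m]" by (metis rev_exhaust)
    then obtain Bs' b where B: "Bs = Bs' @ [b]" using Bs(1) by (cases Bs rule: rev_cases) auto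
    have l: "length Ms' = length Bs'" using Bs(1) Ms B by simp
    have f: "filter P (xs @ [x]) = Ms' @ [m]" using Ms False by simp
    have "concat (map2 (#) (Ms' @ [m]) (Bs' @ [b @ [x]])) =
        concat (map2 (#) (Ms' @ [m]) (Bs' @ [b])) @ [x]"
      using l by simp
    also have "\<dots> = xs @ [x]" using Bs(2) unfolding Ms B by (rule arg_cong[OF sym])
    finally have "length (Bs' @ [b @ [x]]) = length (filter P (xs @ [x])) \<and>
      xs @ [x] = concat (map2 (#) (filter P (xs @ [x])) (Bs' @ [b @ [x]]))"
      unfolding f using l by (metis length_append_singleton)
    then show ?thesis by blast
  qed
qed

lemma ltr_max_decomposition_exists: "\<exists>Ms Bs. ltr_max_decomposition \<pi> Ms Bs"
proof -
  have "is_ltr_max \<pi> (hd \<pi>)" if "\<pi> \<noteq> []"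
    unfolding is_ltr_max_def using that
    by (intro exI[of _ "[]"] exI[of _ "tl \<pi>"]) simp
  from blocks_exist[of \<pi> "is_ltr_max \<pi>", OF this]
  show ?thesis unfolding ltr_max_decomposition_def by auto
qed

end

theory Submission
  imports Defs
begin

text \<open>The second stack sorts its input exactly when that input avoids 231, so \<open>\<pi>\<close> is sortable iff
  the output of the (123,312)-stack avoids 231 (\<open>sortable_iff_avoids_231\<close>).

  The first letter \<open>m\<close> of \<open>\<pi>\<close> governs the (123,312)-stack. Suppose that the stack, read from the
  top, consists of a decreasing list of letters below \<open>m\<close> followed by a decreasing list of
  letters ending in \<open>m\<close>. Its ascents go exactly from a low letter to a high one, and a letter
  may not be pushed as long as both ends of some ascent lie on the same side of it. Hence a new
  letter below \<open>m\<close> pops precisely the larger low letters, and a new letter above \<open>m\<close> pops all low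
  letters and no high one. If some letter above \<open>m\<close> is not a left-to-right maximum, take the
  first such letter \<open>y\<close>: it is pushed on top of a larger letter, and \<open>m\<close> lies at the bottom.
  What lies on the stack leaves it from top to bottom, so the output contains 231
  (\<open>unsorted_high_entries_give_231\<close>). Therefore all block letters must lie below \<open>m\<close>; since the
  letters of \<open>\<pi>\<close> are \<open>1, \<dots>, n\<close>, this says that the maxima are the top \<open>t\<close> values
  (\<open>maxima_are_top_values_iff\<close>), the first condition of the theorem.

  When it holds, each block is processed on its own by a stack that pops every larger letter,
  and the maxima come last, in decreasing order (\<open>pair_run_low_blocks\<close>). Such a stack is the
  mirror image of the 21-stack, so the rule for the latter applies to both: a block avoiding
  213 comes out decreasing, any other block comes out with a 231. Once all blocks come out
  decreasing, an occurrence of 231 has its first letter in an earlier block than its second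
  one; its last two letters lie in different blocks or in the same block, and these are the
  last two conditions (\<open>avoids_231_concat_eager_iff\<close>).\<close>

section \<open>Patterns as subsequences\<close>

lemma order_iso_pair:
  "order_iso s [p, q] \<longleftrightarrow> (\<exists>a b. s = [a, b] \<and> (a < b \<longleftrightarrow> p < q) \<and> (b < a \<longleftrightarrow> q < p))"
proof (cases "\<exists>a b. s = [a, b]")
  case True
  then obtain a b where "s = [a, b]" by blast
  then show ?thesis by (simp add: order_iso_def All_less_Suc conj_commute)
next
  case False
  then show ?thesis by (auto simp: order_iso_def length_Suc_conv)
qed

lemma order_iso_triple:
  "order_iso s [p, q, r] \<longleftrightarrow> (\<exists>a b c. s = [a, b, c] \<and>
     (a < b \<longleftrightarrow> p < q) \<and> (b < a \<longleftrightarrow> q < p) \<and> (a < c \<longleftrightarrow> p < r) \<and> (c < a \<longleftrightarrow> r < p) \<and>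
     (b < c \<longleftrightarrow> q < r) \<and> (c < b \<longleftrightarrow> r < q))"
proof (cases "\<exists>a b c. s = [a, b, c]")
  case True
  then obtain a b c where "s = [a, b, c]" by blast
  then show ?thesis by (simp add: order_iso_def All_less_Suc) (rule iffI; elim conjE; simp)
next
  case False
  then show ?thesis by (auto simp: order_iso_def length_Suc_conv)
qed

lemma contains_21: "contains_pattern w [2, 1] \<longleftrightarrow> (\<exists>a b. subseq [a, b] w \<and> b < a)"
proof -
  have iso: "order_iso s [2, 1] \<longleftrightarrow> (\<exists>a b. s = [a, b] \<and> b < a)" for s
    unfolding order_iso_pair by (intro iff_exI) auto
  show ?thesis unfolding contains_pattern_def iso by blast
qed

lemma contains_123: "contains_pattern w [1, 2, 3] \<longleftrightarrow> (\<exists>a b c. subseq [a, b, c] w \<and> a < b \<and> b < c)"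
proof -
  have iso: "order_iso s [1, 2, 3] \<longleftrightarrow> (\<exists>a b c. s = [a, b, c] \<and> a < b \<and> b < c)" for s
    unfolding order_iso_triple by (intro iff_exI) auto
  show ?thesis unfolding contains_pattern_def iso by blast
qed

lemma contains_312: "contains_pattern w [3, 1, 2] \<longleftrightarrow> (\<exists>a b c. subseq [a, b, c] w \<and> b < c \<and> c < a)"
proof -
  have iso: "order_iso s [3, 1, 2] \<longleftrightarrow> (\<exists>a b c. s = [a, b, c] \<and> b < c \<and> c < a)" for s
    unfolding order_iso_triple by (intro iff_exI) auto
  show ?thesis unfolding contains_pattern_def iso by blast
qed

lemma contains_213: "contains_pattern w [2, 1, 3] \<longleftrightarrow> (\<exists>a b c. subseq [a, b, c] w \<and> b < a \<and> a < c)"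
proof -
  have iso: "order_iso s [2, 1, 3] \<longleftrightarrow> (\<exists>a b c. s = [a, b, c] \<and> b < a \<and> a < c)" for s
    unfolding order_iso_triple by (intro iff_exI) auto
  show ?thesis unfolding contains_pattern_def iso by blast
qed

lemma contains_231: "contains_pattern w [2, 3, 1] \<longleftrightarrow> (\<exists>a b c. subseq [a, b, c] w \<and> c < a \<and> a < b)"
proof -
  have iso: "order_iso s [2, 3, 1] \<longleftrightarrow> (\<exists>a b c. s = [a, b, c] \<and> c < a \<and> a < b)" for s
    unfolding order_iso_triple by (intro iff_exI) auto
  show ?thesis unfolding contains_pattern_def iso by blast
qed

lemma contains_pattern_mono: "subseq v w \<Longrightarrow> contains_pattern v \<tau> \<Longrightarrow> contains_pattern w \<tau>"
  unfolding contains_pattern_def using subseq_order.trans by blast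

lemma subseq_Cons_Cons_iff:
  "subseq (a # as) (x # xs) \<longleftrightarrow> (a = x \<and> subseq as xs) \<or> subseq (a # as) xs"
  by (cases "a = x") (auto dest: subseq_Cons')

lemma subseq_pair_append:
  "subseq [a, b] (xs @ ys) \<longleftrightarrow>
     subseq [a, b] xs \<or> (a \<in> set xs \<and> b \<in> set ys) \<or> subseq [a, b] ys"
  by (induction xs) (auto simp: subseq_Cons_Cons_iff subseq_singleton_left simp del: subseq_Cons2_iff)

lemma subseq_triple_append:
  "subseq [a, b, c] (xs @ ys) \<longleftrightarrow>
     subseq [a, b, c] xs \<or> (subseq [a, b] xs \<and> c \<in> set ys) \<or>
     (a \<in> set xs \<and> subseq [b, c] ys) \<or> subseq [a, b, c] ys"
  by (induction xs)
    (auto simp: subseq_Cons_Cons_iff subseq_pair_append subseq_singleton_left simp del: subseq_Cons2_iff)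

lemma sorted_wrt_iff_subseq: "sorted_wrt P xs \<longleftrightarrow> (\<forall>a b. subseq [a, b] xs \<longrightarrow> P a b)"
  by (induction xs)
    (auto simp: subseq_Cons_Cons_iff subseq_singleton_left simp del: subseq_Cons2_iff)

lemma no_ascent_in_decreasing:
  "sorted_wrt (>) xs \<Longrightarrow> a < b \<Longrightarrow> \<not> subseq [a, b] xs" for a b :: nat
  by (meson less_asym sorted_wrt_iff_subseq)

lemma subseq_memD: "subseq [a, b] xs \<Longrightarrow> a \<in> set xs \<and> b \<in> set xs"
  by (induction xs)
    (auto simp: subseq_Cons_Cons_iff subseq_singleton_left simp del: subseq_Cons2_iff)

lemma subseq_tripleD:
  "subseq [a, b, c] xs \<Longrightarrow> subseq [a, b] xs \<and> subseq [b, c] xs"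
  using subseq_order.trans[of "[a, b]" "[a, b, c]" xs] subseq_Cons'[of a "[b, c]" xs] by simp

section \<open>Eager stacks\<close>

text \<open>A stack on which an incoming letter \<open>x\<close> pops the topmost letters \<open>d\<close> as long as \<open>R x d\<close>; as
  for \<open>stack_run\<close>, the value is the output still to come. The relation \<open>(>)\<close> gives the 21-stack,
  and \<open>(<)\<close> describes what the (123,312)-stack does to a block.\<close>

fun eager_run :: "('a \<Rightarrow> 'a \<Rightarrow> bool) \<Rightarrow> 'a list \<Rightarrow> 'a list \<Rightarrow> 'a list" where
  "eager_run R [] st = st"
| "eager_run R (x # xs) st = takeWhile (R x) st @ eager_run R xs (x # dropWhile (R x) st)"

lemma mset_eager_run: "mset (eager_run R xs st) = mset xs + mset st"
proof (induction xs arbitrary: st)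
  case (Cons x xs)
  have "mset st = mset (takeWhile (R x) st) + mset (dropWhile (R x) st)"
    by (metis mset_append takeWhile_dropWhile_id)
  then show ?case using Cons by simp
qed simp

lemma set_eager_run: "set (eager_run R xs st) = set xs \<union> set st"
  by (metis mset_eager_run set_mset_mset set_mset_union)

lemma subseq_eager_run: "subseq st (eager_run R xs st)"
proof (induction xs arbitrary: st)
  case (Cons x xs)
  have "subseq (dropWhile (R x) st) (eager_run R xs (x # dropWhile (R x) st))"
    using Cons by (meson subseq_Cons')
  then have "subseq (takeWhile (R x) st @ dropWhile (R x) st) (eager_run R (x # xs) st)"
    by (simp only: eager_run.simps subseq_append')
  then show ?case by simp
qed simp

text \<open>Working over an arbitrary strict linear order makes the two stacks instances of one analysis.
  An explicit relation, rather than a type class, allows both \<open>(<)\<close> and \<open>(>)\<close> on the natural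
  numbers.\<close>

locale strict_linear_order =
  fixes R :: "'a \<Rightarrow> 'a \<Rightarrow> bool"
  assumes trans: "R x y \<Longrightarrow> R y z \<Longrightarrow> R x z"
    and asym: "R x y \<Longrightarrow> \<not> R y x"
    and total: "x \<noteq> y \<Longrightarrow> R x y \<or> R y x"
begin

lemma not_popped:
  assumes "sorted_wrt (\<lambda>a b. R b a) st" and "d \<in> set (dropWhile (R x) st)"
  shows "\<not> R x d"
  using assms by (induction st) (auto split: if_splits dest: trans asym)

lemma sorted_push:
  assumes "sorted_wrt (\<lambda>a b. R b a) st" and "x \<notin> set st"
  shows "sorted_wrt (\<lambda>a b. R b a) (x # dropWhile (R x) st)"
proof -
  have "sorted_wrt (\<lambda>a b. R b a) (dropWhile (R x) st)"
    using assms(1) by (metis sorted_wrt_append takeWhile_dropWhile_id)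
  moreover have "R d x" if "d \<in> set (dropWhile (R x) st)" for d
    using not_popped[OF assms(1) that] total that assms(2) by (metis set_dropWhileD)
  ultimately show ?thesis by simp
qed

text \<open>A letter \<open>u\<close> is popped by some \<open>x\<close> with \<open>R x u\<close>, and letters that are still to come may not
  belong in front of \<open>u\<close>: such a \<open>w\<close> would complete the forbidden \<open>u, x, w\<close>. The letters on
  the stack have been read from bottom to top, so \<open>rev st @ xs\<close> is the part of the input that
  still matters.\<close>

lemma eager_run_sorted:
  assumes "sorted_wrt (\<lambda>a b. R b a) st" and "distinct (st @ xs)"
    and "\<And>u v w. subseq [u, v, w] (rev st @ xs) \<Longrightarrow> R v u \<Longrightarrow> \<not> R u w"
  shows "sorted_wrt (\<lambda>a b. R b a) (eager_run R xs st)"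
  using assms
proof (induction xs arbitrary: st)
  case (Cons x xs)
  let ?p = "takeWhile (R x) st" and ?r = "dropWhile (R x) st"
  have st: "st = ?p @ ?r" by simp
  have x: "x \<notin> set st" using Cons.prems by auto
  have "distinct ((x # ?r) @ xs)"
    using Cons.prems(2) by (auto dest: set_dropWhileD)
  moreover have "subseq (rev (x # ?r) @ xs) (rev st @ x # xs)"
    by (subst (2) st, simp only: rev_append) (simp add: subseq_append' subseq_drop_many)
  then have "\<not> R u w" if "subseq [u, v, w] (rev (x # ?r) @ xs)" "R v u" for u v w
    using Cons.prems(3) that subseq_order.trans by blast
  ultimately have later: "sorted_wrt (\<lambda>a b. R b a) (eager_run R xs (x # ?r))"
    using Cons.IH sorted_push[OF Cons.prems(1) x] by blast
  have "R w u" if u: "u \<in> set ?p" and w: "w \<in> set xs \<union> set (x # ?r)" for u w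
  proof -
    have ux: "R x u" "u \<in> set st" using u by (auto dest: set_takeWhileD)
    consider "w = x" | "w \<in> set ?r" | "w \<in> set xs" using w by auto
    then show ?thesis
    proof cases
      case 1
      then show ?thesis using ux by simp
    next
      case 2
      moreover have "sorted_wrt (\<lambda>a b. R b a) (?p @ ?r)" using Cons.prems(1) by simp
      ultimately show ?thesis using u unfolding sorted_wrt_append by blast
    next
      case 3
      then have "subseq [u, x, w] (rev st @ x # xs)"
        using ux by (auto simp: subseq_triple_append subseq_singleton_left)
      then have "\<not> R u w" using Cons.prems(3) ux by blast
      moreover have "u \<noteq> w" using 3 ux Cons.prems(2) by auto
      ultimately show ?thesis using total by blast
    qed
  qed
  moreover have "sorted_wrt (\<lambda>a b. R b a) ?p"
    using Cons.prems(1) by (metis sorted_wrt_append takeWhile_dropWhile_id)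
  ultimately show ?case using later by (simp add: sorted_wrt_append set_eager_run)
qed simp

text \<open>While \<open>w\<close> is awaited, the stack keeps holding a letter that would pop \<open>u\<close>: if one such letter
  is popped, then by transitivity the letter that pops it is another. As \<open>w\<close> does not pop
  letters of this kind, it ends up above one of them.\<close>

lemma eager_run_late_small:
  assumes "v \<in> set st" and "R v u" and "w \<in> set xs" and "R u w"
  shows "\<exists>v'. subseq [w, v'] (eager_run R xs st) \<and> R v' u"
  using assms
proof (induction xs arbitrary: st v)
  case (Cons x xs)
  let ?p = "takeWhile (R x) st" and ?r = "dropWhile (R x) st"
  show ?case
  proof (cases "x = w")
    case True
    have "R v w" using Cons.prems trans by blast
    then have "\<not> R x v" using asym True by blast
    then have "v \<in> set ?r"
      using Cons.prems(1) by (metis Un_iff set_append set_takeWhileD takeWhile_dropWhile_id)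
    then have "subseq [w, v] (x # ?r)" using True by (simp add: subseq_singleton_left)
    then have "subseq [w, v] (eager_run R xs (x # ?r))"
      by (rule subseq_order.trans[OF _ subseq_eager_run])
    then have "subseq [w, v] (eager_run R (x # xs) st)"
      by (simp add: subseq_drop_many)
    then show ?thesis using Cons.prems(2) by blast
  next
    case False
    have "\<exists>v''\<in>set (x # ?r). R v'' u"
    proof (cases "v \<in> set ?r")
      case True
      then show ?thesis using Cons.prems(2) by auto
    next
      case False
      then have "R x v"
        using Cons.prems(1) by (metis Un_iff set_append set_takeWhileD takeWhile_dropWhile_id)
      then have "R x u" using Cons.prems(2) trans by blast
      then show ?thesis by simp
    qed
    moreover have "w \<in> set xs" using Cons.prems(3) False by simp
    ultimately obtain v' where "subseq [w, v'] (eager_run R xs (x # ?r))" "R v' u"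
      using Cons.IH Cons.prems(4) by blast
    then show ?thesis by (auto intro: subseq_drop_many)
  qed
qed simp

text \<open>The letter \<open>u\<close> leaves the stack when \<open>v\<close> is pushed, at the latest, hence before \<open>w\<close> is read.
  The letter that pops \<open>u\<close> need not be \<open>v\<close>, which is why the output pattern ends in some
  unspecified \<open>v'\<close>.\<close>

lemma eager_run_stack_pattern:
  assumes "sorted_wrt (\<lambda>a b. R b a) st" and "distinct (st @ xs)"
    and "u \<in> set st" and "subseq [v, w] xs" and "R v u" and "R u w"
  shows "\<exists>v'. subseq [u, w, v'] (eager_run R xs st) \<and> R v' u"
  using assms
proof (induction xs arbitrary: st)
  case (Cons x xs)
  let ?p = "takeWhile (R x) st" and ?r = "dropWhile (R x) st"
  have x: "x \<notin> set st" using Cons.prems by auto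
  show ?case
  proof (cases "u \<in> set ?r")
    case True
    then have "x \<noteq> v" using not_popped[OF Cons.prems(1)] Cons.prems(5) by blast
    then have "subseq [v, w] xs" using Cons.prems(4) by simp
    moreover have "distinct ((x # ?r) @ xs)"
      using Cons.prems(2) by (auto dest: set_dropWhileD)
    ultimately obtain v' where "subseq [u, w, v'] (eager_run R xs (x # ?r))" "R v' u"
      using Cons.IH[OF sorted_push[OF Cons.prems(1) x]] True Cons.prems(5,6) by auto
    then show ?thesis by (auto intro: subseq_drop_many)
  next
    case False
    then have u: "u \<in> set ?p"
      using Cons.prems(3) by (metis Un_iff set_append takeWhile_dropWhile_id)
    then have "R x u" by (auto dest: set_takeWhileD)
    moreover have "w \<in> set xs"
      using Cons.prems(4) by (auto simp: subseq_Cons_Cons_iff subseq_singleton_left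
          simp del: subseq_Cons2_iff dest: subseq_memD)
    ultimately obtain v' where "subseq [w, v'] (eager_run R xs (x # ?r))" "R v' u"
      using eager_run_late_small[of x "x # ?r" u w xs] Cons.prems(6) by auto
    then show ?thesis using u by (auto simp: subseq_triple_append)
  qed
qed simp

lemma eager_run_pattern:
  assumes "sorted_wrt (\<lambda>a b. R b a) st" and "distinct (st @ xs)"
    and "subseq [u, v, w] xs" and "R v u" and "R u w"
  shows "\<exists>v'. subseq [u, w, v'] (eager_run R xs st) \<and> R v' u"
  using assms
proof (induction xs arbitrary: st)
  case (Cons x xs)
  let ?r = "dropWhile (R x) st"
  have x: "x \<notin> set st" using Cons.prems by auto
  note push = sorted_push[OF Cons.prems(1) x]
  have d: "distinct ((x # ?r) @ xs)"
    using Cons.prems(2) by (auto dest: set_dropWhileD)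
  have "(u = x \<and> subseq [v, w] xs) \<or> subseq [u, v, w] xs"
    using Cons.prems(3) by (simp only: subseq_Cons_Cons_iff)
  then have "\<exists>v'. subseq [u, w, v'] (eager_run R xs (x # ?r)) \<and> R v' u"
  proof
    assume "u = x \<and> subseq [v, w] xs"
    then show ?thesis by (intro eager_run_stack_pattern[OF push d _ _ Cons.prems(4,5)]) simp_all
  next
    assume "subseq [u, v, w] xs"
    then show ?thesis by (intro Cons.IH[OF push d _ Cons.prems(4,5)])
  qed
  then show ?case by (auto intro: subseq_drop_many)
qed simp

end

interpretation less: strict_linear_order "(<) :: nat \<Rightarrow> nat \<Rightarrow> bool"
  by unfold_locales auto

interpretation greater: strict_linear_order "(>) :: nat \<Rightarrow> nat \<Rightarrow> bool"
  by unfold_locales auto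

section \<open>The 21-stack\<close>

lemma pop_before_push_append: "pop_before_push \<Sigma> x st = (p, r) \<Longrightarrow> p @ r = st"
  by (induction st arbitrary: p) (auto split: if_splits prod.splits)

lemma mset_stack_run: "mset (stack_run \<Sigma> xs st) = mset xs + mset st"
proof (induction xs arbitrary: st)
  case (Cons x xs)
  obtain p r where pr: "pop_before_push \<Sigma> x st = (p, r)" by force
  then have "mset st = mset p + mset r" by (metis mset_append pop_before_push_append)
  then show ?case using Cons pr by simp
qed simp

lemma subseq_stack_run: "subseq st (stack_run \<Sigma> xs st)"
proof (induction xs arbitrary: st)
  case (Cons x xs)
  obtain p r where pr: "pop_before_push \<Sigma> x st = (p, r)" by force
  have "subseq r (stack_run \<Sigma> xs (x # r))" using Cons by (meson subseq_Cons')
  then have "subseq (p @ r) (p @ stack_run \<Sigma> xs (x # r))" by (simp only: subseq_append')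
  then show ?case using pr pop_before_push_append[OF pr] by simp
qed simp

text \<open>On a stack that increases from top to bottom, \<open>x\<close> creates a descent iff it creates one with
  the top letter.\<close>

lemma pop_before_push_21:
  assumes "sorted_wrt (<) st" and "x \<notin> set st"
  shows "pop_before_push {[2, 1]} x st = (takeWhile ((>) x) st, dropWhile ((>) x) st)"
  using assms
proof (induction st)
  case (Cons s st)
  have "contains_pattern (x # s # st) [2, 1] \<longleftrightarrow> s < x"
  proof
    assume "contains_pattern (x # s # st) [2, 1]"
    then obtain a b where "subseq [a, b] (x # s # st)" "b < a"
      unfolding contains_21 by blast
    moreover from this have "\<not> subseq [a, b] (s # st)"
      using Cons.prems(1) unfolding sorted_wrt_iff_subseq by fastforce
    ultimately have "b < x" "b \<in> set (s # st)"
      by (auto simp: subseq_Cons_Cons_iff subseq_singleton_left simp del: subseq_Cons2_iff)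
    then show "s < x" using Cons.prems(1) by auto
  next
    assume "s < x"
    then show "contains_pattern (x # s # st) [2, 1]"
      unfolding contains_21 by (intro exI[of _ x] exI[of _ s]) simp
  qed
  then show ?case using Cons by (simp del: One_nat_def)
qed simp

lemma stack_run_21:
  assumes "sorted_wrt (<) st" and "distinct (st @ xs)"
  shows "stack_run {[2, 1]} xs st = eager_run (>) xs st"
  using assms
proof (induction xs arbitrary: st)
  case (Cons x xs)
  then have "sorted_wrt (<) (x # dropWhile ((>) x) st)"
    using greater.sorted_push by auto
  moreover have "distinct ((x # dropWhile ((>) x) st) @ xs)"
    using Cons.prems(2) by (auto dest: set_dropWhileD)
  ultimately show ?case using Cons by (simp add: pop_before_push_21 del: One_nat_def)
qed simp

text \<open>Knuth's criterion for the 21-stack, applied to the output of the first stack, which is again a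
  permutation.\<close>

lemma sortable_iff_avoids_231:
  assumes "\<pi> \<in> permutations_of_set {1..n}"
  shows "sortable \<Sigma> \<pi> \<longleftrightarrow> avoids (stack_map \<Sigma> \<pi>) [2, 3, 1]"
proof -
  let ?w = "stack_map \<Sigma> \<pi>" and ?out = "stack_map {[2, 1]} (stack_map \<Sigma> \<pi>)"
  have \<pi>: "set \<pi> = {1..n}" "distinct \<pi>" using assms by (auto simp: permutations_of_set_def)
  then have len: "length \<pi> = n" by (metis card_atLeastAtMost diff_Suc_1 distinct_card)
  have m: "mset ?w = mset \<pi>" "mset ?out = mset \<pi>"
    by (simp_all add: stack_map_def mset_stack_run)
  have dw: "distinct ?w" using mset_eq_imp_distinct_iff[OF m(1)] \<pi>(2) by simp
  have out: "distinct ?out" "set ?out = {1..n}"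
    using mset_eq_imp_distinct_iff[OF m(2)] mset_eq_setD[OF m(2)] \<pi> by simp_all
  have eager: "?out = eager_run (>) ?w []"
    unfolding stack_map_def[of "{[2, 1]}"] using dw by (intro stack_run_21) simp_all
  have "?out = [1..<n + 1] \<longleftrightarrow> sorted_wrt (<) ?out"
  proof
    assume "sorted_wrt (<) ?out"
    moreover have "set ?out = set [1..<n + 1]" unfolding out(2) by auto
    ultimately show "?out = [1..<n + 1]"
      by (intro strict_sorted_equal) (simp_all only: sorted_wrt_upt)
  next
    assume "?out = [1..<n + 1]"
    then show "sorted_wrt (<) ?out" by (simp only: sorted_wrt_upt)
  qed
  also have "\<dots> \<longleftrightarrow> avoids ?w [2, 3, 1]"
  proof
    assume sorted: "sorted_wrt (<) ?out"
    show "avoids ?w [2, 3, 1]"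
    proof
      assume "contains_pattern ?w [2, 3, 1]"
      then obtain u v w where "subseq [u, v, w] ?w" "w < u" "u < v"
        unfolding contains_231 by blast
      then obtain v' where "subseq [u, w, v'] ?out" "u < v'"
        using greater.eager_run_pattern[of "[]" ?w u v w] dw unfolding eager by auto
      then have "subseq [u, w] ?out"
        using subseq_tripleD[of u w v' ?out] by blast
      then show False using sorted \<open>w < u\<close> unfolding sorted_wrt_iff_subseq by (meson less_asym)
    qed
  next
    assume "avoids ?w [2, 3, 1]"
    then have "\<not> w < u" if "subseq [u, v, w] ?w" "u < v" for u v w
      using that unfolding contains_231 by blast
    then show "sorted_wrt (<) ?out"
      unfolding eager using dw by (intro greater.eager_run_sorted) simp_all
  qed
  finally show ?thesis by (simp add: sortable_def len)
qed

section \<open>The (123,312)-stack\<close>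

abbreviation pair_run :: "nat list \<Rightarrow> nat list \<Rightarrow> nat list" where
  "pair_run \<equiv> stack_run {[1, 2, 3], [3, 1, 2]}"

text \<open>The ascents of the stack are the pairs of a low and a high letter; so the stack itself contains
  no pattern, and \<open>x\<close> creates one exactly if it lies below or above both ends of an ascent. If
  any high letter serves as the upper end, then so does the smallest one, \<open>last Rs\<close>.\<close>

lemma push_forbidden_iff:
  assumes "sorted_wrt (>) ds" and "sorted_wrt (>) Rs" and "Rs \<noteq> []"
    and "\<And>d. d \<in> set ds \<Longrightarrow> d < last Rs"
  shows "(\<exists>\<sigma>\<in>{[1, 2, 3], [3, 1, 2]}. contains_pattern (x # ds @ Rs) \<sigma>) \<longleftrightarrow>
     (\<exists>d\<in>set ds. x < d \<or> last Rs < x)"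
proof -
  have low: "last Rs \<le> r" if "r \<in> set Rs" for r
    using assms(2,3) that by (induction Rs rule: rev_induct) (auto simp: sorted_wrt_append)
  have asc: "subseq [a, b] (ds @ Rs) \<and> a < b \<longleftrightarrow> a \<in> set ds \<and> b \<in> set Rs" for a b
  proof -
    have "\<not> subseq [a, b] ds" "\<not> subseq [a, b] Rs" if "a < b"
      using assms(1,2) that no_ascent_in_decreasing by blast+
    moreover have "a < b" if "a \<in> set ds" "b \<in> set Rs"
      using assms(4)[OF that(1)] low[OF that(2)] by simp
    ultimately show ?thesis unfolding subseq_pair_append by blast
  qed
  \<comment> \<open>In 123 and in 312 the last two letters ascend.\<close>
  have three: "False" if "subseq [a, b, c] (ds @ Rs)" "b < c" "c < a \<or> a < b" for a b c
  proof -
    have "subseq [b, c] (ds @ Rs)" using that(1) by (meson subseq_Cons')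
    then have bc: "b \<in> set ds" "c \<in> set Rs" using asc that(2) by blast+
    have ab: "subseq [a, b] (ds @ Rs)"
      using subseq_tripleD[OF that(1)] by blast
    have "b \<notin> set Rs" using assms(4)[OF bc(1)] low leD by blast
    then have "a \<in> set ds" "\<not> a < b"
      using ab asc by (auto simp: subseq_pair_append dest: subseq_memD)
    then show False using that(3) assms(4) low[OF bc(2)] by fastforce
  qed
  have lastR: "last Rs \<in> set Rs" using assms(3) by simp
  show ?thesis
  proof
    assume "\<exists>\<sigma>\<in>{[1, 2, 3], [3, 1, 2]}. contains_pattern (x # ds @ Rs) \<sigma>"
    then obtain a b c where abc: "subseq [a, b, c] (x # ds @ Rs)" "(a < b \<and> b < c) \<or> (b < c \<and> c < a)"
      unfolding contains_123 contains_312 bex_simps by blast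
    then have "a = x" "subseq [b, c] (ds @ Rs)"
      using three[of a b c] by (auto simp: subseq_Cons_Cons_iff simp del: subseq_Cons2_iff)
    moreover have "b < c" using abc by blast
    ultimately have "b \<in> set ds" "c \<in> set Rs" using asc by blast+
    then show "\<exists>d\<in>set ds. x < d \<or> last Rs < x"
      using abc(2) low[of c] \<open>a = x\<close> by force
  next
    assume "\<exists>d\<in>set ds. x < d \<or> last Rs < x"
    then obtain d where d: "d \<in> set ds" "x < d \<or> last Rs < x" by blast
    then have "subseq [d, last Rs] (ds @ Rs)" "d < last Rs" using asc lastR by blast+
    then have "subseq [x, d, last Rs] (x # ds @ Rs)" by simp
    then show "\<exists>\<sigma>\<in>{[1, 2, 3], [3, 1, 2]}. contains_pattern (x # ds @ Rs) \<sigma>"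
      using d(2) \<open>d < last Rs\<close> unfolding bex_simps contains_123 contains_312 by blast
  qed
qed

lemma pop_high:
  assumes "sorted_wrt (>) ds" and "sorted_wrt (>) Rs" and "Rs \<noteq> []"
    and "\<And>d. d \<in> set ds \<Longrightarrow> d < last Rs" and "last Rs < x"
  shows "pop_before_push {[1, 2, 3], [3, 1, 2]} x (ds @ Rs) = (ds, Rs)"
  using assms(1,4)
proof (induction ds)
  case Nil
  obtain r Rs' where Rs: "Rs = r # Rs'" using assms(3) by (cases Rs) auto
  show ?case using push_forbidden_iff[of "[]" Rs x] assms(2,3) by (simp add: Rs)
next
  case (Cons d ds)
  then show ?case using push_forbidden_iff[of "d # ds" Rs x] assms(2,3,5) by fastforce
qed

lemma pop_low:
  assumes "sorted_wrt (>) ds" and "sorted_wrt (>) Rs" and "Rs \<noteq> []"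
    and "\<And>d. d \<in> set ds \<Longrightarrow> d < last Rs" and "x < last Rs"
  shows "pop_before_push {[1, 2, 3], [3, 1, 2]} x (ds @ Rs) =
     (takeWhile ((<) x) ds, dropWhile ((<) x) ds @ Rs)"
  using assms(1,4)
proof (induction ds)
  case Nil
  obtain r Rs' where Rs: "Rs = r # Rs'" using assms(3) by (cases Rs) auto
  show ?case using push_forbidden_iff[of "[]" Rs x] assms(2,3) by (simp add: Rs)
next
  case (Cons d ds)
  have "(\<exists>e\<in>set (d # ds). x < e \<or> last Rs < x) \<longleftrightarrow> x < d"
    using Cons.prems(1) assms(5) by force
  then show ?case using push_forbidden_iff[of "d # ds" Rs x] assms(2,3) Cons by fastforce
qed

text \<open>Both the end of the input and a following letter above \<open>last Rs\<close> release the low letters that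
  are left on the stack, just as the end of its input does for the eager stack.\<close>

lemma pair_run_block:
  assumes "sorted_wrt (>) ds" and "sorted_wrt (>) Rs" and "Rs \<noteq> []"
    and "\<And>d. d \<in> set ds \<union> set B \<Longrightarrow> d < last Rs" and "distinct (ds @ B)"
    and "ys = [] \<or> last Rs < hd ys"
  shows "pair_run (B @ ys) (ds @ Rs) = eager_run (<) B ds @ pair_run ys Rs"
  using assms(1,4,5)
proof (induction B arbitrary: ds)
  case Nil
  show ?case
  proof (cases ys)
    case (Cons y ys')
    then have "last Rs < y" using assms(6) by simp
    then show ?thesis
      using pop_high[of ds Rs y] pop_high[of "[]" Rs y] Nil assms(2,3) Cons by simp
  qed simp
next
  case (Cons x B)
  have "sorted_wrt (>) (x # dropWhile ((<) x) ds)"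
    using less.sorted_push[of ds x] Cons.prems by simp
  moreover have "distinct ((x # dropWhile ((<) x) ds) @ B)"
    using Cons.prems(3) by (auto dest: set_dropWhileD)
  moreover have "d < last Rs" if "d \<in> set (x # dropWhile ((<) x) ds) \<union> set B" for d
    using that Cons.prems(2) by (auto dest: set_dropWhileD)
  ultimately have "pair_run (B @ ys) ((x # dropWhile ((<) x) ds) @ Rs) =
      eager_run (<) B (x # dropWhile ((<) x) ds) @ pair_run ys Rs"
    using Cons.IH by blast
  then show ?case using pop_low[of ds Rs x] Cons.prems assms(2,3) by simp
qed

lemma pair_run_low_blocks:
  assumes "length Bs = length Ms" and "sorted_wrt (>) (rev Ms @ Rs)"
    and "\<And>B b m. B \<in> set Bs \<Longrightarrow> b \<in> set B \<Longrightarrow> m \<in> set Ms \<union> set Rs \<Longrightarrow> b < m"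
    and "\<And>B. B \<in> set Bs \<Longrightarrow> distinct B"
  shows "pair_run (concat (map2 (#) Ms Bs)) Rs =
     concat (map (\<lambda>B. eager_run (<) B []) Bs) @ rev Ms @ Rs"
  using assms
proof (induction Bs Ms arbitrary: Rs rule: list_induct2)
  case (Cons B Bs M Ms)
  let ?rest = "concat (map2 (#) Ms Bs)"
  have desc: "sorted_wrt (>) (M # Rs)" using Cons.prems(1) by (simp add: sorted_wrt_append)
  have last: "last (M # Rs) \<in> set (M # Rs)" by (rule last_in_set) simp
  have first: "pair_run (M # B @ ?rest) Rs = pair_run (B @ ?rest) (M # Rs)"
  proof (cases "Rs = []")
    case False
    then have "last Rs < M" using desc by simp
    then show ?thesis using pop_high[of "[]" Rs M] False desc by simp
  qed simp
  have "?rest = [] \<or> last (M # Rs) < hd ?rest"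
  proof (cases Ms)
    case Nil
    then show ?thesis by simp
  next
    case (Cons M' Ms')
    then obtain B' Bs' where "Bs = B' # Bs'" using \<open>length Bs = length Ms\<close> by (cases Bs) auto
    moreover have "last (M # Rs) < M'"
      using Cons.prems(1) Cons last by (auto simp: sorted_wrt_append)
    ultimately show ?thesis using Cons by simp
  qed
  moreover have low: "d < last (M # Rs)" if "d \<in> set B" for d
    using Cons.prems(2)[of B d "last (M # Rs)"] that last by auto
  ultimately have "pair_run (B @ ?rest) (M # Rs) = eager_run (<) B [] @ pair_run ?rest (M # Rs)"
    using pair_run_block[of "[]" "M # Rs" B ?rest] desc low Cons.prems(3) by simp
  moreover have "pair_run ?rest (M # Rs) =
      concat (map (\<lambda>B. eager_run (<) B []) Bs) @ rev Ms @ M # Rs"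
    using Cons.prems by (intro Cons.IH) auto
  ultimately show ?case using first by simp
qed simp

text \<open>In the state reached so far, \<open>rev Rs\<close> lists the high letters that have been read. The hypothesis
  on these and the coming high letters is invariant under reading a letter, until some \<open>y\<close> between
  \<open>last Rs\<close> and \<open>hd Rs\<close> arrives and \<open>y, hd Rs, last Rs\<close> are on the stack.\<close>

lemma unsorted_high_entries_give_231:
  assumes "sorted_wrt (>) ds" and "sorted_wrt (>) Rs" and "Rs \<noteq> []"
    and "\<And>d. d \<in> set ds \<Longrightarrow> d < last Rs" and "distinct (ds @ Rs @ ys)"
    and "\<not> sorted_wrt (<) (rev Rs @ filter ((<) (last Rs)) ys)"
  shows "contains_pattern (pair_run ys (ds @ Rs)) [2, 3, 1]"
  using assms
proof (induction ys arbitrary: ds Rs)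
  case Nil
  then show ?case by (simp add: sorted_wrt_rev)
next
  case (Cons y ys)
  have ne: "y \<noteq> last Rs" "y \<noteq> hd Rs" using Cons.prems(3,5) by auto
  consider "y < last Rs" | "last Rs < y" "hd Rs < y" | "last Rs < y" "y < hd Rs"
    using ne by linarith
  then show ?case
  proof cases
    case 1
    have "contains_pattern (pair_run ys ((y # dropWhile ((<) y) ds) @ Rs)) [2, 3, 1]"
    proof (rule Cons.IH)
      show "sorted_wrt (>) (y # dropWhile ((<) y) ds)"
        using less.sorted_push[of ds y] Cons.prems by simp
      show "distinct ((y # dropWhile ((<) y) ds) @ Rs @ ys)"
        using Cons.prems(5) by (auto dest: set_dropWhileD)
      show "d < last Rs" if "d \<in> set (y # dropWhile ((<) y) ds)" for d
        using that Cons.prems(4) 1 by (auto dest: set_dropWhileD)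
      show "\<not> sorted_wrt (<) (rev Rs @ filter ((<) (last Rs)) ys)"
        using Cons.prems(6) 1 by simp
    qed (use Cons.prems in auto)
    then show ?thesis
      using pop_low[of ds Rs y] Cons.prems 1 
      by (auto intro: contains_pattern_mono[OF subseq_drop_many[OF subseq_order.refl]])
  next
    case 2
    have "contains_pattern (pair_run ys ([] @ y # Rs)) [2, 3, 1]"
    proof (rule Cons.IH)
      show "sorted_wrt (>) (y # Rs)"
        using Cons.prems(2,3) 2 by (cases Rs) auto
      show "\<not> sorted_wrt (<) (rev (y # Rs) @ filter ((<) (last (y # Rs))) ys)"
        using Cons.prems(3,6) 2 by simp
    qed (use Cons.prems in auto)
    then show ?thesis
      using pop_high[of ds Rs y] Cons.prems 2
      by (auto intro: contains_pattern_mono[OF subseq_drop_many[OF subseq_order.refl]])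
  next
    case 3
    then obtain r Rs' where Rs: "Rs = r # Rs'" "Rs' \<noteq> []"
      using Cons.prems(3) by (cases Rs) (auto split: if_splits)
    have "subseq (y # Rs) (pair_run (y # ys) (ds @ Rs))"
      using pop_high[of ds Rs y] Cons.prems 3 subseq_stack_run[of "y # Rs"]
      by (auto intro: subseq_drop_many)
    moreover have "subseq [y, r, last Rs] (y # Rs)"
      using Rs by (simp add: subseq_singleton_left)
    ultimately have "subseq [y, r, last Rs] (pair_run (y # ys) (ds @ Rs))"
      using subseq_order.trans by blast
    then show ?thesis using 3 Rs unfolding contains_231 by auto
  qed
qed

section \<open>Patterns across blocks\<close>

lemma subseq_concat_later:
  assumes "i < length Cs" and "x \<in> set (Cs ! i)" and "subseq s (concat (drop (Suc i) Cs))"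
  shows "subseq (x # s) (concat Cs)"
proof -
  have "concat Cs = concat (take i Cs) @ Cs ! i @ concat (drop (Suc i) Cs)"
    by (metis assms(1) concat.simps(2) concat_append id_take_nth_drop)
  moreover have "subseq ([x] @ s) (Cs ! i @ concat (drop (Suc i) Cs))"
    using assms(2,3) by (intro list_emb_append_mono) (simp_all add: subseq_singleton_left)
  ultimately show ?thesis by (simp add: subseq_drop_many)
qed

lemma subseq_concat_nth:
  assumes "i < length Cs" and "subseq s (Cs ! i)"
  shows "subseq s (concat Cs)"
proof -
  have "concat Cs = concat (take i Cs) @ Cs ! i @ concat (drop (Suc i) Cs)"
    by (metis assms(1) concat.simps(2) concat_append id_take_nth_drop)
  then show ?thesis using assms(2) by (simp add: subseq_drop_many subseq_rev_drop_many)
qed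

lemma subseq_pair_concatD:
  assumes "subseq [b, c] (concat Cs)"
  shows "\<exists>j k. j \<le> k \<and> k < length Cs \<and> b \<in> set (Cs ! j) \<and> c \<in> set (Cs ! k)"
  using assms
proof (induction Cs)
  case (Cons C Cs)
  then consider "subseq [b, c] C" | "b \<in> set C" "c \<in> set (concat Cs)" | "subseq [b, c] (concat Cs)"
    by (auto simp: subseq_pair_append)
  then show ?case
  proof cases
    case 1
    then show ?thesis using subseq_memD[OF 1] by (intro exI[of _ 0]) simp
  next
    case 2
    then obtain k where "k < length Cs" "c \<in> set (Cs ! k)" 
      unfolding set_concat by (metis UN_E in_set_conv_nth)
    then show ?thesis using 2 by (intro exI[of _ 0] exI[of _ "Suc k"]) auto
  next
    case 3
    then obtain j k where "j \<le> k" "k < length Cs" "b \<in> set (Cs ! j)" "c \<in> set (Cs ! k)"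
      using Cons.IH by blast
    then show ?thesis by (intro exI[of _ "Suc j"] exI[of _ "Suc k"]) auto
  qed
qed simp

text \<open>Only the first two letters of a 231 form an ascent, so these two cannot share a decreasing list.\<close>

lemma contains_231_concatD:
  fixes Cs :: "nat list list"
  assumes "\<And>C. C \<in> set Cs \<Longrightarrow> sorted_wrt (>) C"
    and "subseq [a, b, c] (concat Cs)" and "c < a" and "a < b"
  shows "\<exists>i j k. i < j \<and> j \<le> k \<and> k < length Cs \<and>
    a \<in> set (Cs ! i) \<and> b \<in> set (Cs ! j) \<and> c \<in> set (Cs ! k)"
  using assms(1,2)
proof (induction Cs)
  case (Cons C Cs)
  have "\<not> subseq [a, b] C"
    by (rule no_ascent_in_decreasing[OF Cons.prems(1)[OF list.set_intros(1)] assms(4)])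
  moreover from this have "\<not> subseq [a, b, c] C"
    using subseq_tripleD[of a b c C] by blast
  ultimately consider "a \<in> set C" "subseq [b, c] (concat Cs)" | "subseq [a, b, c] (concat Cs)"
    using Cons.prems(2) by (auto simp: subseq_triple_append)
  then show ?case
  proof cases
    case 1
    then obtain j k where "j \<le> k" "k < length Cs" "b \<in> set (Cs ! j)" "c \<in> set (Cs ! k)"
      using subseq_pair_concatD[OF 1(2)] by blast
    then show ?thesis using 1
      by (intro exI[of _ 0] exI[of _ "Suc j"] exI[of _ "Suc k"]) auto
  next
    case 2
    then obtain i j k where "i < j" "j \<le> k" "k < length Cs"
      "a \<in> set (Cs ! i)" "b \<in> set (Cs ! j)" "c \<in> set (Cs ! k)"
      using Cons.IH[OF Cons.prems(1)[OF list.set_intros(2)] 2] by blast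
    then show ?thesis
      by (intro exI[of _ "Suc i"] exI[of _ "Suc j"] exI[of _ "Suc k"]) auto
  qed
qed simp

lemma contains_231_concatI:
  assumes "\<And>C. C \<in> set Cs \<Longrightarrow> sorted_wrt (>) C"
    and "i < j" and "j \<le> k" and "k < length Cs"
    and "a \<in> set (Cs ! i)" and "b \<in> set (Cs ! j)" and "c \<in> set (Cs ! k)"
    and "c < a" and "a < b"
  shows "contains_pattern (concat Cs) [2, 3, 1]"
proof -
  let ?Ds = "drop (Suc i) Cs"
  have nth: "?Ds ! (j - Suc i) = Cs ! j" "j - Suc i < length ?Ds"
    using assms(2-4) by simp_all
  have "subseq [b, c] (concat ?Ds)"
  proof (cases "j = k")
    case True
    have "sorted_wrt (>) (Cs ! k)" using assms(1,4) by simp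
    moreover obtain us vs where "Cs ! k = us @ b # vs"
      using assms(6) True by (auto simp: in_set_conv_decomp)
    ultimately have "subseq [b, c] (Cs ! k)"
      using assms(7-9) by (auto simp: sorted_wrt_append subseq_pair_append subseq_singleton_left)
    then show ?thesis using subseq_concat_nth[OF nth(2)] nth(1) True by simp
  next
    case False
    have "k - Suc j < length (drop (Suc j) Cs)" "drop (Suc j) Cs ! (k - Suc j) = Cs ! k"
      using False assms(2-4) by simp_all
    then have "subseq [c] (concat (drop (Suc j) Cs))"
      using assms(7) subseq_concat_nth[of "k - Suc j" "drop (Suc j) Cs" "[c]"]
      by (simp add: subseq_singleton_left)
    moreover have "drop (Suc (j - Suc i)) ?Ds = drop (Suc j) Cs" using assms(2) by simp
    ultimately show ?thesis using subseq_concat_later[OF nth(2)] nth(1) assms(6) by simp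
  qed
  then have "subseq [a, b, c] (concat Cs)"
    using assms(2-4) by (intro subseq_concat_later[OF _ assms(5)]) simp
  then show ?thesis using assms(8,9) unfolding contains_231 by blast
qed

lemma contains_231_append_decreasing:
  assumes "sorted_wrt (>) Hs" and "\<And>l h. l \<in> set L \<Longrightarrow> h \<in> set Hs \<Longrightarrow> l < h"
  shows "contains_pattern (L @ Hs) [2, 3, 1] \<longleftrightarrow> contains_pattern L [2, 3, 1]"
proof
  assume "contains_pattern (L @ Hs) [2, 3, 1]"
  then obtain a b c where abc: "subseq [a, b, c] (L @ Hs)" "c < a" "a < b"
    unfolding contains_231 by blast
  have "\<not> subseq [a, b] Hs"
    using assms(1) abc(3) by (rule no_ascent_in_decreasing)
  then have "\<not> subseq [a, b, c] Hs"
    using subseq_tripleD[of a b c Hs] by blast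
  moreover have "\<not> (a \<in> set L \<and> c \<in> set Hs)" using assms(2)[of a c] abc(2) by auto
  ultimately have "subseq [a, b, c] L"
    using abc(1) subseq_memD[of a b L] subseq_memD[of b c Hs] by (auto simp: subseq_triple_append)
  then show "contains_pattern L [2, 3, 1]" using abc unfolding contains_231 by blast
qed (rule contains_pattern_mono[OF subseq_rev_drop_many[OF subseq_order.refl]])

text \<open>The eager stack permutes the letters of each block, so conditions on membership in the blocks
  carry over to the output. The order of the last two letters inside one block is irrelevant in
  the input, because the output of the block is decreasing.\<close>

lemma avoids_231_concat_eager_iff:
  assumes "\<forall>B\<in>set Bs. distinct B"
  shows "avoids (concat (map (\<lambda>B. eager_run (<) B []) Bs)) [2, 3, 1] \<longleftrightarrow>
      (\<forall>i<length Bs. avoids (Bs ! i) [2, 1, 3]) \<and>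
      (\<nexists>i j k x y z. i < j \<and> j < k \<and> k < length Bs \<and>
         x \<in> set (Bs ! i) \<and> y \<in> set (Bs ! j) \<and> z \<in> set (Bs ! k) \<and> z < x \<and> x < y) \<and>
      (\<nexists>i j x y z. i < j \<and> j < length Bs \<and>
         x \<in> set (Bs ! i) \<and> y \<in> set (Bs ! j) \<and> z \<in> set (Bs ! j) \<and> z < x \<and> x < y)"
    (is "avoids (concat ?Cs) _ \<longleftrightarrow> ?inner \<and> \<not> ?apart \<and> \<not> ?joint")
proof -
  have len: "length ?Cs = length Bs" by simp
  have nth: "?Cs ! i = eager_run (<) (Bs ! i) []" if "i < length Bs" for i
    using that by simp
  have set: "set (?Cs ! i) = set (Bs ! i)" if "i < length Bs" for i
    using nth[OF that] by (simp add: set_eager_run)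
  have inner: ?inner if av: "avoids (concat ?Cs) [2, 3, 1]"
  proof (intro allI impI notI)
    fix i assume i: "i < length Bs" and "contains_pattern (Bs ! i) [2, 1, 3]"
    then obtain u v w where uvw: "subseq [u, v, w] (Bs ! i)" "v < u" "u < w"
      unfolding contains_213 by blast
    have "distinct ([] @ Bs ! i)" using assms i by simp
    from less.eager_run_pattern[OF _ this uvw]
    obtain v' where "subseq [u, w, v'] (?Cs ! i)" "v' < u" unfolding nth[OF i] by auto
    then have "contains_pattern (concat ?Cs) [2, 3, 1]"
      unfolding contains_231 using subseq_concat_nth[of i ?Cs "[u, w, v']"] len i uvw(3) by metis
    with av show False by blast
  qed
  have dec: "sorted_wrt (>) C" if inn: ?inner and C: "C \<in> set ?Cs" for C
  proof -
    obtain i where i: "i < length Bs" and Ci: "C = ?Cs ! i"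
      using C unfolding in_set_conv_nth len by blast
    have "\<not> u < w" if "subseq [u, v, w] (Bs ! i)" "v < u" for u v w
      using inn i that unfolding contains_213 by blast
    moreover have "distinct (Bs ! i)" using assms i by simp
    ultimately show ?thesis
      unfolding Ci nth[OF i] by (intro less.eager_run_sorted) simp_all
  qed
  have across: "contains_pattern (concat ?Cs) [2, 3, 1] \<longleftrightarrow> ?apart \<or> ?joint" if inn: ?inner
  proof
    assume "contains_pattern (concat ?Cs) [2, 3, 1]"
    then obtain a b c where abc: "subseq [a, b, c] (concat ?Cs)" "c < a" "a < b"
      unfolding contains_231 by blast
    obtain i j k where ijk: "i < j" "j \<le> k" "k < length Bs"
      "a \<in> set (?Cs ! i)" "b \<in> set (?Cs ! j)" "c \<in> set (?Cs ! k)"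
      using contains_231_concatD[OF dec[OF inn] abc] unfolding len by blast
    have "i < length Bs" "j < length Bs" using ijk(1-3) by simp_all
    note mem = ijk(4)[unfolded set[OF this(1)]] ijk(5)[unfolded set[OF this(2)]]
      ijk(6)[unfolded set[OF ijk(3)]]
    show "?apart \<or> ?joint"
    proof (cases "j = k")
      case True
      then have ?joint using ijk(1,3) mem abc(2,3) by blast
      then show ?thesis ..
    next
      case False
      then have "j < k" using ijk(2) by simp
      then have ?apart using ijk(1,3) mem abc(2,3) by blast
      then show ?thesis ..
    qed
  next
    have gen: "contains_pattern (concat ?Cs) [2, 3, 1]"
      if "i < j" "j \<le> k" "k < length Bs" "x \<in> set (Bs ! i)" "y \<in> set (Bs ! j)"
        "z \<in> set (Bs ! k)" "z < x" "x < y" for i j k x y z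
    proof (rule contains_231_concatI[OF dec[OF inn] that(1,2) _ _ _ _ that(7,8)])
      show "x \<in> set (?Cs ! i)" "y \<in> set (?Cs ! j)" "z \<in> set (?Cs ! k)"
        using that set[of i] set[of j] set[of k] by simp_all
    qed (use that(3) in simp_all)
    assume "?apart \<or> ?joint"
    then show "contains_pattern (concat ?Cs) [2, 3, 1]"
    proof
      assume ?apart
      then obtain i j k x y z where h: "i < j" "j < k" "k < length Bs" "x \<in> set (Bs ! i)"
        "y \<in> set (Bs ! j)" "z \<in> set (Bs ! k)" "z < x" "x < y"
        by blast
      show ?thesis by (rule gen[OF h(1) less_imp_le_nat[OF h(2)] h(3-8)])
    next
      assume ?joint
      then obtain i j x y z where h: "i < j" "j < length Bs" "x \<in> set (Bs ! i)"
        "y \<in> set (Bs ! j)" "z \<in> set (Bs ! j)" "z < x" "x < y"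
        by blast
      show ?thesis by (rule gen[OF h(1) order_refl h(2-7)])
    qed
  qed
  show ?thesis using inner across by blast
qed

section \<open>The decomposition\<close>

lemma ltr_maxima_increasing:
  assumes "distinct \<pi>"
  shows "sorted_wrt (<) (filter (is_ltr_max \<pi>) \<pi>)"
  unfolding sorted_wrt_iff_subseq
proof (intro allI impI)
  fix a b assume ab: "subseq [a, b] (filter (is_ltr_max \<pi>) \<pi>)"
  then have "subseq [a, b] \<pi>" by (rule subseq_order.trans) (rule subseq_filter_left)
  moreover have "is_ltr_max \<pi> b" using subseq_memD[OF ab] by simp
  then obtain us vs where \<pi>: "\<pi> = us @ b # vs" and us: "\<forall>u\<in>set us. u < b"
    unfolding is_ltr_max_def by blast
  ultimately have "subseq [a, b] (us @ b # vs)" "b \<notin> set us" "b \<notin> set vs"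
    using assms by auto
  then have "a \<in> set us"
    by (auto simp: subseq_pair_append subseq_Cons_Cons_iff subseq_singleton_left
        simp del: subseq_Cons2_iff dest: subseq_memD[of a b us] subseq_memD[of a b vs])
  then show "a < b" using us by blast
qed

lemma mset_interleaved_blocks:
  "length Ms = length Bs \<Longrightarrow> mset (concat (map2 (#) Ms Bs)) = mset (Ms @ concat Bs)"
  by (induction Ms Bs rule: list_induct2) auto

text \<open>Both sides say that the set of maxima is upward closed in \<open>{1..n}\<close>, i.e. that it consists of the
  largest \<open>t\<close> values; listed in increasing order, they are \<open>n - t + 1, \<dots>, n\<close>.\<close>

lemma maxima_are_top_values_iff:
  assumes "sorted_wrt (<) Ms" and "set Ms \<union> U = {1..n}" and "set Ms \<inter> U = {}"
    and "t = length Ms"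
  shows "(\<forall>j\<in>{1..t}. Ms ! (j - 1) = n - t + j) \<longleftrightarrow> (\<forall>b\<in>U. \<forall>m\<in>set Ms. b < m)"
proof -
  have t: "card (set Ms) = t" using assms(1,4) by (simp add: distinct_card strict_sorted_iff)
  then have "t \<le> n" using assms(2) card_mono[of "{1..n}" "set Ms"] by auto
  have "(\<forall>j\<in>{1..t}. Ms ! (j - 1) = n - t + j) \<longleftrightarrow> (\<forall>i<t. Ms ! i = n - t + Suc i)"
  proof
    assume "\<forall>j\<in>{1..t}. Ms ! (j - 1) = n - t + j"
    then show "\<forall>i<t. Ms ! i = n - t + Suc i"
      by (metis Suc_leI atLeastAtMost_iff diff_Suc_1 le_add1 plus_1_eq_Suc)
  qed auto
  also have "\<dots> \<longleftrightarrow> Ms = [n - t + 1..<n + 1]"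
    using \<open>t \<le> n\<close> assms(4) by (auto simp: list_eq_iff_nth_eq simp del: upt_Suc)
  also have "\<dots> \<longleftrightarrow> set Ms = {n - t + 1..n}"
  proof
    assume "set Ms = {n - t + 1..n}"
    then have "set Ms = set [n - t + 1..<n + 1]"
      by (simp add: atLeastLessThanSuc_atLeastAtMost del: upt_Suc)
    then show "Ms = [n - t + 1..<n + 1]"
      using assms(1) by (intro strict_sorted_equal) (simp_all only: sorted_wrt_upt)
  next
    assume "Ms = [n - t + 1..<n + 1]"
    then show "set Ms = {n - t + 1..n}" by auto
  qed
  also have "\<dots> \<longleftrightarrow> (\<forall>b\<in>U. \<forall>m\<in>set Ms. b < m)"
  proof
    assume top: "set Ms = {n - t + 1..n}"
    show "\<forall>b\<in>U. \<forall>m\<in>set Ms. b < m"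
    proof (intro ballI)
      fix b m assume "b \<in> U" "m \<in> set Ms"
      then have "b \<notin> {n - t + 1..n}" "b \<le> n" "n - t + 1 \<le> m"
        using top assms(2,3) by auto
      then show "b < m" by auto
    qed
  next
    assume low: "\<forall>b\<in>U. \<forall>m\<in>set Ms. b < m"
    show "set Ms = {n - t + 1..n}"
    proof (cases "Ms = []")
      case True
      then show ?thesis using assms(4) by simp
    next
      case False
      define m where "m = Min (set Ms)"
      have m: "m \<in> set Ms" unfolding m_def using False by simp
      then have mn: "1 \<le> m" "m \<le> n" using assms(2) by auto
      have "set Ms = {m..n}"
      proof
        show "set Ms \<subseteq> {m..n}" using assms(2) unfolding m_def by auto
        show "{m..n} \<subseteq> set Ms"
        proof
          fix x assume x: "x \<in> {m..n}"
          then have "x \<in> set Ms \<union> U" unfolding assms(2) using mn by simp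
          then show "x \<in> set Ms" using low m x by fastforce
        qed
      qed
      moreover from this have "m = n - t + 1" using t mn by simp
      ultimately show ?thesis by simp
    qed
  qed
  finally show ?thesis .
qed

lemma is_ltr_max_of_sorted_high_entries:
  assumes "sorted_wrt (<) (m # filter ((<) m) ys)" and "x \<in> set ys" and "m < x"
  shows "is_ltr_max (m # ys) x"
proof -
  obtain us vs where ys: "ys = us @ x # vs" using split_list[OF assms(2)] by blast
  have "filter ((<) m) ys = filter ((<) m) us @ x # filter ((<) m) vs"
    using assms(3) unfolding ys by simp
  then have "sorted_wrt (<) (filter ((<) m) us @ x # filter ((<) m) vs)"
    using assms(1) by (simp only: sorted_wrt.simps)
  then have "\<forall>u\<in>set us. m < u \<longrightarrow> u < x" by (simp add: sorted_wrt_append)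
  then have "\<forall>u\<in>set (m # us). u < x" using assms(3) by (auto simp: not_less)
  then show ?thesis unfolding is_ltr_max_def ys
    by (intro exI[of _ "m # us", OF exI[of _ vs]]) simp
qed

text \<open>If some block letter exceeds some maximum, then it exceeds the first letter of \<open>\<pi>\<close>, so that the
  high letters are not sorted and both sides fail; otherwise the output is known explicitly.\<close>

theorem theorem6p21:
  fixes n t :: nat and \<pi> Ms :: "nat list" and Bs :: "nat list list"
  assumes "\<pi> \<in> permutations_of_set {1..n}"
    and "ltr_max_decomposition \<pi> Ms Bs"
    and "t = length Ms"
  shows "sortable {[1, 2, 3], [3, 1, 2]} \<pi> \<longleftrightarrow>
      (\<forall>j\<in>{1..t}. Ms ! (j - 1) = n - t + j) \<and>
      (\<forall>i<t. avoids (Bs ! i) [2, 1, 3]) \<and>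
      (\<nexists>i j k x y z. i < j \<and> j < k \<and> k < t \<and>
         x \<in> set (Bs ! i) \<and> y \<in> set (Bs ! j) \<and> z \<in> set (Bs ! k) \<and> z < x \<and> x < y) \<and>
      (\<nexists>i j x y z. i < j \<and> j < t \<and>
         x \<in> set (Bs ! i) \<and> y \<in> set (Bs ! j) \<and> z \<in> set (Bs ! j) \<and> z < x \<and> x < y)"
proof -
  let ?U = "set (concat Bs)"
  have \<pi>: "set \<pi> = {1..n}" "distinct \<pi>" using assms(1) by (auto simp: permutations_of_set_def)
  have Ms: "Ms = filter (is_ltr_max \<pi>) \<pi>" and len: "length Bs = length Ms"
    and conc: "\<pi> = concat (map2 (#) Ms Bs)"
    using assms(2) unfolding ltr_max_decomposition_def by blast+
  have inc: "sorted_wrt (<) Ms" unfolding Ms using \<pi>(2) by (rule ltr_maxima_increasing)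
  have mset: "mset \<pi> = mset (Ms @ concat Bs)"
    unfolding conc by (rule mset_interleaved_blocks) (simp add: len)
  have dist: "distinct (Ms @ concat Bs)" using mset_eq_imp_distinct_iff[OF mset] \<pi>(2) by simp
  have "set (Ms @ concat Bs) = {1..n}" using mset_eq_setD[OF mset] \<pi>(1) by (rule subst)
  then have sets: "set Ms \<union> ?U = {1..n}" "set Ms \<inter> ?U = {}" using dist by auto
  note sort = sortable_iff_avoids_231[OF assms(1), of "{[1, 2, 3], [3, 1, 2]}"]
  note top = maxima_are_top_values_iff[OF inc sets assms(3)]
  show ?thesis
  proof (cases "\<forall>b\<in>?U. \<forall>m\<in>set Ms. b < m")
    case True
    have desc: "sorted_wrt (>) (rev Ms)" using inc by (simp add: sorted_wrt_rev)
    have dB: "\<forall>B\<in>set Bs. distinct B"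
      using dist by (auto simp: distinct_concat_iff)
    have "pair_run \<pi> [] = concat (map (\<lambda>B. eager_run (<) B []) Bs) @ rev Ms @ []"
      unfolding conc
      by (rule pair_run_low_blocks) (use len desc True dB in auto)
    then have out: "avoids (stack_map {[1, 2, 3], [3, 1, 2]} \<pi>) [2, 3, 1] \<longleftrightarrow>
        avoids (concat (map (\<lambda>B. eager_run (<) B []) Bs)) [2, 3, 1]"
      unfolding stack_map_def
      using contains_231_append_decreasing[OF desc, of "concat (map (\<lambda>B. eager_run (<) B []) Bs)"] True
      by (simp add: set_eager_run del: One_nat_def)
    note blocks = avoids_231_concat_eager_iff[OF dB, unfolded len assms(3)[symmetric]]
    show ?thesis
      unfolding sort out blocks
      by (rule iffI, rule conjI[OF iffD2[OF top True]], assumption, erule conjunct2)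
  next
    case False
    then obtain b m' where b: "b \<in> ?U" "m' \<in> set Ms" "m' < b"
      using sets(2) by (metis disjoint_iff linorder_neqE_nat)
    obtain m Ms' where m: "Ms = m # Ms'" using b(2) by (cases Ms) auto
    obtain B Bs' where "Bs = B # Bs'" using len m by (cases Bs) auto
    then obtain ys where ys: "\<pi> = m # ys" using conc m by auto
    have "m < b" using b(2,3) inc m by auto
    have "b \<in> set \<pi>" "b \<notin> set Ms" using b(1) sets \<pi>(1) by auto
    then have "\<not> is_ltr_max \<pi> b" unfolding Ms by simp
    moreover have "b \<in> set ys" using \<open>b \<in> set \<pi>\<close> \<open>m < b\<close> ys by simp
    ultimately have "\<not> sorted_wrt (<) (m # filter ((<) m) ys)"
      using is_ltr_max_of_sorted_high_entries \<open>m < b\<close> unfolding ys by blast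
    then have "contains_pattern (pair_run ys ([] @ [m])) [2, 3, 1]"
      using \<pi>(2) ys by (intro unsorted_high_entries_give_231) auto
    then have "\<not> sortable {[1, 2, 3], [3, 1, 2]} \<pi>"
      unfolding sort unfolding stack_map_def ys by simp
    then show ?thesis using top False by blast
  qed
qed

end
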